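(* Let $P$ be a total GPEA and let $U$ be the unitization of $P$ by a unitizing GPEA-automorphism $\gamma$. Then $P$ has RDP (RDP$_0$, RDP$_1$, RDP$_2$, respectively) iff $U$ has RDP (RDP$_0$, RDP$_1$, RDP$_2$, respectively).
   Context: $P$ is a GPEA (partial $\oplus$, constant $0$; partial associativity; conjugation; two-sided cancellation; neutral $0$; positivity), ordered by $a\le b$ iff $a\oplus c=b$ for some $c$; for $a\le b$, $a/b$ is the unique $c$ with $a\oplus c=b$ and $b\backslash a$ the unique $d$ with $d\oplus a=b$. $P$ is total iff $a\oplus b$ is defined for all $a,b$. $\gamma$ is a unitizing GPEA-automorphism ($\gamma a\oplus b$ defined iff $b\oplus a$ defined). The unitization by $\gamma$ ($\gamma$-unitization) $U=P\cup P^\eta$ ($\eta$ a bijection onto a disjoint set, $1:=\eta0$): sums in $P$ as in $P$; $a+\eta b$ defined iff $a\le b$, equal to $\eta(b\backslash a)$; $\eta a+b$ defined iff $\gamma b\le a$, equal to $\eta(\gamma b/a)$; no sums within $P^\eta$; $U$ is a pseudo effect algebra. RDP: whenever $a\oplus b=c\oplus d$ there are $e_{11},e_{12},e_{21},e_{22}$ with $a=e_{11}\oplus e_{12}$, $b=e_{21}\oplus e_{22}$, $c=e_{11}\oplus e_{21}$, $d=e_{12}\oplus e_{22}$. RDP$_1$: moreover the decomposition can be chosen so that whenever $f\le e_{12}$, $g\le e_{21}$, then $f\oplus g=g\oplus f$. RDP$_2$: moreover $e_{12}\wedge e_{21}=0$. RDP$_0$: if $a\le b\oplus c$ then $a=b_1\oplus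 c_1$ for some $b_1\le b$, $c_1\le c$. *)

theory Defs
  imports Main
begin

text \<open>A partial binary operation is a function into the option type: \<open>s a b = None\<close> says that
  \<open>a \<oplus> b\<close> is undefined.  An informal equation between sums always asserts that
  both sides are defined.  The carrier of a GPEA is the whole type.\<close>

type_synonym 'a partial_op = "'a \<Rightarrow> 'a \<Rightarrow> 'a option"

text \<open>In \<open>assoc\<close>, equality of the two bound options says that \<open>a \<oplus> b\<close> and
  \<open>(a \<oplus> b) \<oplus> c\<close> are defined iff \<open>b \<oplus> c\<close> and \<open>a \<oplus> (b \<oplus> c)\<close> are, and that the two
  values then agree.\<close>

locale gpea =
  fixes s :: "'a partial_op" and zero :: 'a
  assumes assoc: "Option.bind (s a b) (\<lambda>x. s x c) = Option.bind (s b c) (\<lambda>x. s a x)"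
    and conjugation: "s a b = Some x \<Longrightarrow> \<exists>d e. s d a = Some x \<and> s b e = Some x"
    and cancel_right: "s a c = Some x \<Longrightarrow> s b c = Some x \<Longrightarrow> a = b"
    and cancel_left: "s c a = Some x \<Longrightarrow> s c b = Some x \<Longrightarrow> a = b"
    and zero_right: "s a zero = Some a"
    and zero_left: "s zero a = Some a"
    and positivity: "s a b = Some zero \<Longrightarrow> a = zero \<and> b = zero"

definition total_op :: "'a partial_op \<Rightarrow> bool" where
  "total_op s \<longleftrightarrow> (\<forall>a b. s a b \<noteq> None)"

definition ple :: "'a partial_op \<Rightarrow> 'a \<Rightarrow> 'a \<Rightarrow> bool" where
  "ple s a b \<longleftrightarrow> (\<exists>c. s a c = Some b)"

text \<open>\<open>ldiff s a b\<close> is \<open>a/b\<close> and \<open>rdiff s b a\<close> is \<open>b\<close> backslash \<open>a\<close>; both are meaningful only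
  when \<open>ple s a b\<close>.\<close>

definition ldiff :: "'a partial_op \<Rightarrow> 'a \<Rightarrow> 'a \<Rightarrow> 'a" where
  "ldiff s a b = (THE c. s a c = Some b)"

definition rdiff :: "'a partial_op \<Rightarrow> 'a \<Rightarrow> 'a \<Rightarrow> 'a" where
  "rdiff s b a = (THE d. s d a = Some b)"

definition gpea_morphism :: "'a partial_op \<Rightarrow> 'b partial_op \<Rightarrow> ('a \<Rightarrow> 'b) \<Rightarrow> bool" where
  "gpea_morphism s t f \<longleftrightarrow> (\<forall>a b x. s a b = Some x \<longrightarrow> t (f a) (f b) = Some (f x))"

definition gpea_automorphism :: "'a partial_op \<Rightarrow> ('a \<Rightarrow> 'a) \<Rightarrow> bool" where
  "gpea_automorphism s f \<longleftrightarrow> bij f \<and> gpea_morphism s s f \<and> gpea_morphism s s (inv f)"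

definition unitizing_automorphism :: "'a partial_op \<Rightarrow> ('a \<Rightarrow> 'a) \<Rightarrow> bool" where
  "unitizing_automorphism s \<gamma> \<longleftrightarrow>
     gpea_automorphism s \<gamma> \<and> (\<forall>a b. s (\<gamma> a) b \<noteq> None \<longleftrightarrow> s b a \<noteq> None)"

text \<open>The \<open>\<gamma>\<close>-unitization lives on the disjoint union: \<open>Inl a\<close> is the element \<open>a\<close> of \<open>P\<close> and
  \<open>Inr a\<close> is \<open>\<eta> a\<close>.  Its zero is \<open>Inl zero\<close> and its unit is \<open>Inr zero\<close>.\<close>

fun unitization :: "'a partial_op \<Rightarrow> ('a \<Rightarrow> 'a) \<Rightarrow> ('a + 'a) partial_op" where
  "unitization s \<gamma> (Inl a) (Inl b) = map_option Inl (s a b)"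
| "unitization s \<gamma> (Inl a) (Inr b) = (if ple s a b then Some (Inr (rdiff s b a)) else None)"
| "unitization s \<gamma> (Inr a) (Inl b) =
     (if ple s (\<gamma> b) a then Some (Inr (ldiff s (\<gamma> b) a)) else None)"
| "unitization s \<gamma> (Inr a) (Inr b) = None"

definition is_meet :: "'a partial_op \<Rightarrow> 'a \<Rightarrow> 'a \<Rightarrow> 'a \<Rightarrow> bool" where
  "is_meet s a b m \<longleftrightarrow>
     ple s m a \<and> ple s m b \<and> (\<forall>x. ple s x a \<longrightarrow> ple s x b \<longrightarrow> ple s x m)"

definition refines ::
  "'a partial_op \<Rightarrow> 'a \<Rightarrow> 'a \<Rightarrow> 'a \<Rightarrow> 'a \<Rightarrow> 'a \<Rightarrow> 'a \<Rightarrow> 'a \<Rightarrow> 'a \<Rightarrow> bool" where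
  "refines s a b c d e11 e12 e21 e22 \<longleftrightarrow>
     s e11 e12 = Some a \<and> s e21 e22 = Some b \<and> s e11 e21 = Some c \<and> s e12 e22 = Some d"

definition RDP :: "'a partial_op \<Rightarrow> bool" where
  "RDP s \<longleftrightarrow> (\<forall>a b c d x. s a b = Some x \<longrightarrow> s c d = Some x \<longrightarrow>
     (\<exists>e11 e12 e21 e22. refines s a b c d e11 e12 e21 e22))"

definition RDP0 :: "'a partial_op \<Rightarrow> bool" where
  "RDP0 s \<longleftrightarrow> (\<forall>a b c x. s b c = Some x \<longrightarrow> ple s a x \<longrightarrow>
     (\<exists>b1 c1. ple s b1 b \<and> ple s c1 c \<and> s b1 c1 = Some a))"

definition RDP1 :: "'a partial_op \<Rightarrow> bool" where
  "RDP1 s \<longleftrightarrow> (\<forall>a b c d x. s a b = Some x \<longrightarrow> s c d = Some x \<longrightarrow>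
     (\<exists>e11 e12 e21 e22. refines s a b c d e11 e12 e21 e22 \<and>
        (\<forall>f g. ple s f e12 \<longrightarrow> ple s g e21 \<longrightarrow> (\<exists>h. s f g = Some h \<and> s g f = Some h))))"

definition RDP2 :: "'a partial_op \<Rightarrow> 'a \<Rightarrow> bool" where
  "RDP2 s zero \<longleftrightarrow> (\<forall>a b c d x. s a b = Some x \<longrightarrow> s c d = Some x \<longrightarrow>
     (\<exists>e11 e12 e21 e22. refines s a b c d e11 e12 e21 e22 \<and> is_meet s e12 e21 zero))"

end

(* Since P is total, it is the positive cone of a partially ordered group, and the only sums of U
   outside P are Inl a + Inr b = Inr c iff c + a = b, and Inr a + Inl b = Inr c iff \<gamma> b + c = a.
   Elements of P lie below every Inr b, and every element below an element of P is in P; this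
   already gives the direction from U to P.  For the converse, consider two decompositions of Inr x.
   If the component from P is on the same side in both, then refining two equal sums of P that
   extend these components yields a refinement in U, because the off-diagonal entries of any
   refinement commute by cancellation.  If the sides differ, there is a refinement with a
   zero off-diagonal entry.  For RDP0, an element below a sum of the form Inr x always splits, with
   one part equal to zero or to the summand from P. *)

theory Submission
  imports Defs
begin

section \<open>Arithmetic of a total GPEA\<close>

locale total_gpea = gpea +
  assumes total: "total_op s"
begin

definition add :: "'a \<Rightarrow> 'a \<Rightarrow> 'a" (infixl "\<oplus>" 65) where
  "a \<oplus> b = the (s a b)"

lemma s_eq: "s a b = Some (a \<oplus> b)"
  using total unfolding total_op_def add_def by auto

lemma add_assoc: "(a \<oplus> b) \<oplus> c = a \<oplus> (b \<oplus> c)"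
  using assoc[of a b c] by (simp add: s_eq)

lemma add_zero [simp]: "a \<oplus> zero = a" "zero \<oplus> a = a"
  using zero_right[of a] zero_left[of a] by (simp_all add: s_eq)

lemma add_cancel [simp]: "a \<oplus> b = a \<oplus> c \<longleftrightarrow> b = c" "b \<oplus> a = c \<oplus> a \<longleftrightarrow> b = c"
  using cancel_left[of a b _ c] cancel_right[of b a _ c] by (auto simp: s_eq)

lemma add_eq_zero [simp]: "a \<oplus> b = zero \<longleftrightarrow> a = zero \<and> b = zero"
    "zero = a \<oplus> b \<longleftrightarrow> a = zero \<and> b = zero"
  using positivity[of a b] by (auto simp: s_eq)

lemma ex_swap_left: "\<exists>d. d \<oplus> a = a \<oplus> b"
  using conjugation[OF s_eq] by (auto simp: s_eq)

lemma ex_swap_right: "\<exists>e. b \<oplus> e = a \<oplus> b"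
  using conjugation[OF s_eq] by (auto simp: s_eq)

lemma ple_iff: "ple s a b \<longleftrightarrow> (\<exists>c. b = a \<oplus> c)"
  by (auto simp: ple_def s_eq)

text \<open>Conjugation turns a left summand into a right summand and back, so the order is
  two-sided.\<close>

lemma ple_iff': "ple s a b \<longleftrightarrow> (\<exists>c. b = c \<oplus> a)"
  unfolding ple_iff by (metis ex_swap_left ex_swap_right)

lemma rdiff_add [simp]: "rdiff s (c \<oplus> a) a = c"
  by (auto simp: rdiff_def s_eq)

lemma ldiff_add [simp]: "ldiff s a (a \<oplus> c) = c"
  by (auto simp: ldiff_def s_eq)

lemma refines_iff:
  "refines s a b c d e11 e12 e21 e22 \<longleftrightarrow>
     a = e11 \<oplus> e12 \<and> b = e21 \<oplus> e22 \<and> c = e11 \<oplus> e21 \<and> d = e12 \<oplus> e22"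
  by (auto simp: refines_def s_eq)

text \<open>Both sums expand to the four entries, with only the two middle ones in different order;
  cancelling \<open>e11\<close> and \<open>e22\<close> leaves the claim.\<close>

lemma refines_commute:
  assumes "a \<oplus> b = c \<oplus> d" "refines s a b c d e11 e12 e21 e22"
  shows "e12 \<oplus> e21 = e21 \<oplus> e12"
proof -
  have "e11 \<oplus> (e12 \<oplus> e21 \<oplus> e22) = e11 \<oplus> (e21 \<oplus> e12 \<oplus> e22)"
    using assms by (simp add: refines_iff add_assoc)
  then show ?thesis by simp
qed

end

section \<open>Sums and order in the unitization\<close>

locale total_gpea_unitization = total_gpea +
  fixes \<gamma> :: "'a \<Rightarrow> 'a"
  assumes unitizing: "unitizing_automorphism s \<gamma>"
begin

abbreviation u :: "('a + 'a) partial_op" where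
  "u \<equiv> unitization s \<gamma>"

lemma aut_add: "\<gamma> (a \<oplus> b) = \<gamma> a \<oplus> \<gamma> b"
  using unitizing
  unfolding unitizing_automorphism_def gpea_automorphism_def gpea_morphism_def
  by (simp add: s_eq)

lemma aut_surj: "\<exists>b. a = \<gamma> b"
  using unitizing
  unfolding unitizing_automorphism_def gpea_automorphism_def
  by (meson bij_pointE)

lemma aut_zero [simp]: "\<gamma> zero = zero"
proof -
  have "\<gamma> zero \<oplus> \<gamma> zero = \<gamma> zero \<oplus> zero"
    using aut_add[of zero zero] by simp
  then show ?thesis by (simp only: add_cancel)
qed

lemma u_Inl_Inl [simp]: "u (Inl a) (Inl b) = Some (Inl (a \<oplus> b))"
  by (simp add: s_eq)

text \<open>If \<open>b = c \<oplus> a\<close>, then \<open>rdiff s b a\<close> is \<open>c\<close>;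
  so partial differences give way to equations in the total operation.\<close>

lemma u_Inl_Inr [simp]: "u (Inl a) (Inr b) = Some z \<longleftrightarrow> (\<exists>c. z = Inr c \<and> b = c \<oplus> a)"
  by (auto simp: ple_iff')

lemma u_Inr_Inl [simp]: "u (Inr a) (Inl b) = Some z \<longleftrightarrow> (\<exists>c. z = Inr c \<and> a = \<gamma> b \<oplus> c)"
  by (auto simp: ple_iff)

declare unitization.simps [simp del]

lemma u_Inr_Inr [simp]: "u (Inr a) (Inr b) = None"
  by (simp add: unitization.simps)

lemma u_eq_Inl:
  "u x y = Some (Inl z) \<longleftrightarrow> (\<exists>a b. x = Inl a \<and> y = Inl b \<and> z = a \<oplus> b)"
  by (cases x; cases y) auto

lemma u_eq_Inr:
  "u x y = Some (Inr z) \<longleftrightarrow>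
     (\<exists>a. x = Inl a \<and> y = Inr (z \<oplus> a)) \<or> (\<exists>b. x = Inr (\<gamma> b \<oplus> z) \<and> y = Inl b)"
  by (cases x; cases y) auto

lemma ple_u_Inl: "ple u x (Inl b) \<longleftrightarrow> (\<exists>a. x = Inl a \<and> ple s a b)"
  by (auto simp: ple_def u_eq_Inl s_eq)

lemma all_ple_u_Inl: "(\<forall>x. ple u x (Inl b) \<longrightarrow> R x) \<longleftrightarrow> (\<forall>a. ple s a b \<longrightarrow> R (Inl a))"
  by (auto simp: ple_u_Inl)

text \<open>The missing summand is \<open>Inr (b \<oplus> a)\<close>, which exists by
  totality.\<close>

lemma ple_u_Inl_Inr: "ple u (Inl a) (Inr b)"
  by (auto simp: ple_def u_eq_Inr)

text \<open>Adding \<open>Inl c\<close> on the right strips \<open>\<gamma> c\<close> from the left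
  of \<open>a\<close>, which reverses the order; as \<open>\<gamma>\<close> is onto,
  \<open>\<gamma> c\<close> can be any element.\<close>

lemma ple_u_Inr_Inr: "ple u (Inr a) (Inr b) \<longleftrightarrow> ple s b a"
proof -
  have "ple u (Inr a) (Inr b) \<longleftrightarrow> (\<exists>c. a = \<gamma> c \<oplus> b)"
    by (auto simp: ple_def u_eq_Inr)
  also have "\<dots> \<longleftrightarrow> ple s b a"
    unfolding ple_iff' using aut_surj by metis
  finally show ?thesis .
qed

lemma u_zero: "u (Inl zero) x = Some x" "u x (Inl zero) = Some x"
  by (cases x; simp)+

lemma ple_u_zero: "ple u x (Inl zero) \<longleftrightarrow> x = Inl zero"
  by (auto simp: ple_u_Inl ple_iff)

section \<open>Refinement properties: RDP, RDP1 and RDP2\<close>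

lemma refines_u_Inl:
  "refines u (Inl a) (Inl b) (Inl c) (Inl d) E11 E12 E21 E22 \<longleftrightarrow>
     (\<exists>e11 e12 e21 e22. E11 = Inl e11 \<and> E12 = Inl e12 \<and> E21 = Inl e21 \<and> E22 = Inl e22 \<and>
        refines s a b c d e11 e12 e21 e22)"
  by (auto simp: refines_def u_eq_Inl s_eq)

text \<open>The properties RDP, RDP1 and RDP2 differ only in the condition imposed on the off-diagonal
  entries of the refinement, so they are treated together with that condition as a parameter.\<close>

lemma refinement_unitization_iff:
  assumes Q_Inl: "\<And>a b. Q' (Inl a) (Inl b) \<longleftrightarrow> Q a b"
    and Q_zero: "\<And>X. Q' (Inl zero) X" "\<And>X. Q' X (Inl zero)"
  shows "(\<forall>a b c d x. s a b = Some x \<longrightarrow> s c d = Some x \<longrightarrow>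
            (\<exists>e11 e12 e21 e22. refines s a b c d e11 e12 e21 e22 \<and> Q e12 e21)) \<longleftrightarrow>
         (\<forall>a b c d x. u a b = Some x \<longrightarrow> u c d = Some x \<longrightarrow>
            (\<exists>e11 e12 e21 e22. refines u a b c d e11 e12 e21 e22 \<and> Q' e12 e21))"
    (is "?P \<longleftrightarrow> ?U")
proof
  assume U: ?U
  show ?P
  proof (intro allI impI)
    fix a b c d x
    assume "s a b = Some x" "s c d = Some x"
    then have "u (Inl a) (Inl b) = Some (Inl x)" "u (Inl c) (Inl d) = Some (Inl x)"
      by (simp_all add: s_eq)
    then obtain E11 E12 E21 E22
      where "refines u (Inl a) (Inl b) (Inl c) (Inl d) E11 E12 E21 E22" "Q' E12 E21"
      using U by blast
    then show "\<exists>e11 e12 e21 e22. refines s a b c d e11 e12 e21 e22 \<and> Q e12 e21"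
      using Q_Inl unfolding refines_u_Inl by blast
  qed
next
  assume ?P
  then have P: "\<exists>e11 e12 e21 e22. refines s a b c d e11 e12 e21 e22 \<and> Q e12 e21"
    if "a \<oplus> b = c \<oplus> d" for a b c d
    using that by (simp add: s_eq)
  show ?U
  proof (intro allI impI)
    fix A B C D X
    assume AB: "u A B = Some X" and CD: "u C D = Some X"
    show "\<exists>E11 E12 E21 E22. refines u A B C D E11 E12 E21 E22 \<and> Q' E12 E21"
    proof (cases X)
      case (Inl x)
      then obtain a b c d where
        eqs: "A = Inl a" "B = Inl b" "C = Inl c" "D = Inl d" "a \<oplus> b = c \<oplus> d"
        using AB CD by (auto simp: u_eq_Inl)
      obtain e11 e12 e21 e22 where "refines s a b c d e11 e12 e21 e22" "Q e12 e21"
        using P[OF eqs(5)] by blast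
      then have "refines u A B C D (Inl e11) (Inl e12) (Inl e21) (Inl e22)" "Q' (Inl e12) (Inl e21)"
        using eqs Q_Inl by (simp_all add: refines_u_Inl)
      then show ?thesis by blast
    next
      case (Inr x)
      \<comment> \<open>The letters tell on which side the summand from \<open>P\<close> stands in
        \<open>A + B\<close> and in \<open>C + D\<close>.\<close>
      consider
        (ll) a c where "A = Inl a" "B = Inr (x \<oplus> a)" "C = Inl c" "D = Inr (x \<oplus> c)"
      | (lr) a d where "A = Inl a" "B = Inr (x \<oplus> a)" "C = Inr (\<gamma> d \<oplus> x)" "D = Inl d"
      | (rl) b c where "A = Inr (\<gamma> b \<oplus> x)" "B = Inl b" "C = Inl c" "D = Inr (x \<oplus> c)"
      | (rr) b d where "A = Inr (\<gamma> b \<oplus> x)" "B = Inl b" "C = Inr (\<gamma> d \<oplus> x)" "D = Inl d"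
        using AB CD unfolding Inr u_eq_Inr by blast
      then show ?thesis
      proof cases
        case ll
        \<comment> \<open>Conjugation extends \<open>a\<close> and \<open>c\<close> on the right to
          a common sum, to which the hypothesis on \<open>P\<close> applies.\<close>
        obtain q where q: "a \<oplus> c = c \<oplus> q"
          using ex_swap_right by metis
        obtain e11 e12 e21 e22 where e: "refines s a c c q e11 e12 e21 e22" "Q e12 e21"
          using P[OF q] by blast
        have ac: "a = e11 \<oplus> e12" "c = e11 \<oplus> e21"
          using e(1) unfolding refines_iff by blast+
        \<comment> \<open>Only \<open>e22\<close> is replaced. The new entry must also equal
          \<open>x \<oplus> c \<oplus> e12\<close>, which holds since \<open>e12\<close> and
          \<open>e21\<close> commute.\<close>
        have "refines u A B C D (Inl e11) (Inl e12) (Inl e21) (Inr (x \<oplus> a \<oplus> e21))"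
          using ac refines_commute[OF q e(1)] ll by (simp add: refines_def add_assoc)
        then show ?thesis using e(2) Q_Inl by blast
      next
        case lr
        \<comment> \<open>With \<open>zero\<close> as upper right entry, the diagonal must be
          \<open>A\<close> and \<open>D\<close>, and the equation for \<open>C\<close> then
          determines the remaining entry.\<close>
        have "refines u A B C D (Inl a) (Inl zero) (Inr (\<gamma> d \<oplus> x \<oplus> a)) (Inl d)"
          using lr by (simp add: refines_def add_assoc)
        then show ?thesis using Q_zero by blast
      next
        case rl
        have "refines u A B C D (Inl c) (Inr (\<gamma> b \<oplus> x \<oplus> c)) (Inl zero) (Inl b)"
          using rl by (simp add: refines_def add_assoc)
        then show ?thesis using Q_zero by blast
      next
        case rr
        \<comment> \<open>Mirror image of the first case: \<open>b\<close> and \<open>d\<close> are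
          extended on the left, and \<open>e11\<close> is the entry to be replaced.\<close>
        obtain p where p: "p \<oplus> b = b \<oplus> d"
          using ex_swap_left by metis
        obtain e11 e12 e21 e22 where e: "refines s p b b d e11 e12 e21 e22" "Q e12 e21"
          using P[OF p] by blast
        have comm: "\<gamma> e12 \<oplus> \<gamma> e21 = \<gamma> e21 \<oplus> \<gamma> e12"
          using refines_commute[OF p e(1)] by (metis aut_add)
        have b: "b = e21 \<oplus> e22" and d: "d = e12 \<oplus> e22"
          using e(1) unfolding refines_iff by blast+
        have "\<gamma> e12 \<oplus> (\<gamma> b \<oplus> x) = \<gamma> e21 \<oplus> (\<gamma> d \<oplus> x)"
          unfolding b d aut_add using comm by (metis add_assoc)
        then have "refines u A B C D (Inr (\<gamma> e12 \<oplus> (\<gamma> b \<oplus> x))) (Inl e12) (Inl e21) (Inl e22)"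
          using b d rr by (simp add: refines_def)
        then show ?thesis using e(2) Q_Inl by blast
      qed
    qed
  qed
qed

lemma RDP_unitization_iff: "RDP s \<longleftrightarrow> RDP u"
  using refinement_unitization_iff[of "\<lambda>_ _. True" "\<lambda>_ _. True"] unfolding RDP_def by simp

lemma RDP1_unitization_iff: "RDP1 s \<longleftrightarrow> RDP1 u"
  unfolding RDP1_def
proof (rule refinement_unitization_iff)
  show "(\<forall>f g. ple u f (Inl a) \<longrightarrow> ple u g (Inl b) \<longrightarrow> (\<exists>h. u f g = Some h \<and> u g f = Some h)) \<longleftrightarrow>
      (\<forall>f g. ple s f a \<longrightarrow> ple s g b \<longrightarrow> (\<exists>h. s f g = Some h \<and> s g f = Some h))" for a b
    by (simp add: all_ple_u_Inl s_eq)
\<comment> \<open>Only \<open>Inl zero\<close> lies below \<open>Inl zero\<close>, and it commutes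
  with everything.\<close>
qed (simp_all add: ple_u_zero u_zero)

lemma RDP2_unitization_iff: "RDP2 s zero \<longleftrightarrow> RDP2 u (Inl zero)"
  unfolding RDP2_def
proof (rule refinement_unitization_iff)
  show "is_meet u (Inl a) (Inl b) (Inl zero) \<longleftrightarrow> is_meet s a b zero" for a b
    by (auto simp: is_meet_def ple_u_Inl)
  have "ple u (Inl zero) X" for X
    by (auto simp: ple_def u_zero)
  then show "is_meet u (Inl zero) X (Inl zero)" "is_meet u X (Inl zero) (Inl zero)" for X
    by (auto simp: is_meet_def)
qed

section \<open>The property RDP0\<close>

lemma RDP0_unitization_iff: "RDP0 s \<longleftrightarrow> RDP0 u"
proof
  assume U: "RDP0 u"
  show "RDP0 s"
    unfolding RDP0_def
  proof (intro allI impI)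
    fix a b c x
    assume "s b c = Some x" "ple s a x"
    then have "u (Inl b) (Inl c) = Some (Inl x)" "ple u (Inl a) (Inl x)"
      by (auto simp: s_eq ple_u_Inl)
    then obtain B1 C1 where "ple u B1 (Inl b)" "ple u C1 (Inl c)" "u B1 C1 = Some (Inl a)"
      using U unfolding RDP0_def by blast
    moreover from this obtain b1 c1 where "B1 = Inl b1" "C1 = Inl c1" "ple s b1 b" "ple s c1 c"
      by (auto simp: ple_u_Inl)
    ultimately have "ple s b1 b" "ple s c1 c" "s b1 c1 = Some a"
      by (simp_all add: s_eq)
    then show "\<exists>b1 c1. ple s b1 b \<and> ple s c1 c \<and> s b1 c1 = Some a" by blast
  qed
next
  assume P: "RDP0 s"
  show "RDP0 u"
    unfolding RDP0_def
  proof (intro allI impI)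
    fix A B C X
    assume BC: "u B C = Some X" and le: "ple u A X"
    show "\<exists>B1 C1. ple u B1 B \<and> ple u C1 C \<and> u B1 C1 = Some A"
    proof (cases X)
      case (Inl x)
      then obtain a b c where "A = Inl a" "B = Inl b" "C = Inl c" "s b c = Some x" "ple s a x"
        using BC le by (auto simp: u_eq_Inl ple_u_Inl s_eq)
      moreover from this obtain b1 c1 where "ple s b1 b" "ple s c1 c" "s b1 c1 = Some a"
        using P unfolding RDP0_def by blast
      ultimately have "ple u (Inl b1) B" "ple u (Inl c1) C" "u (Inl b1) (Inl c1) = Some A"
        by (auto simp: ple_u_Inl s_eq)
      then show ?thesis by blast
    next
      case X: (Inr x)
      consider (l) b where "B = Inl b" "C = Inr (x \<oplus> b)" | (r) c where "B = Inr (\<gamma> c \<oplus> x)" "C = Inl c"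
        using BC unfolding X u_eq_Inr by blast
      then show ?thesis
      proof cases
        case l
        show ?thesis
        proof (cases A)
          case (Inl a)
          have "ple u (Inl zero) B" "ple u (Inl a) C" "u (Inl zero) (Inl a) = Some A"
            using l Inl by (auto simp: ple_u_Inl ple_iff ple_u_Inl_Inr)
          then show ?thesis by blast
        next
          case (Inr a)
          then obtain z where z: "a = x \<oplus> z"
            using le X by (auto simp: ple_u_Inr_Inr ple_iff)
          \<comment> \<open>Moving \<open>z\<close> past \<open>b\<close> shows that
            \<open>a \<oplus> b\<close> lies above \<open>x \<oplus> b\<close>, which by order
            reversal puts \<open>Inr (a \<oplus> b)\<close> below \<open>C\<close>.\<close>
          obtain z' where "b \<oplus> z' = z \<oplus> b"
            using ex_swap_right by blast
          then have "x \<oplus> z \<oplus> b = x \<oplus> b \<oplus> z'"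
            by (simp add: add_assoc)
          then have "ple u (Inl b) B" "ple u (Inr (a \<oplus> b)) C" "u (Inl b) (Inr (a \<oplus> b)) = Some A"
            using l Inr z by (auto simp: ple_u_Inl ple_u_Inr_Inr ple_iff intro: exI[of _ zero])
          then show ?thesis by blast
        qed
      next
        case r
        show ?thesis
        proof (cases A)
          case (Inl a)
          have "ple u (Inl a) B" "ple u (Inl zero) C" "u (Inl a) (Inl zero) = Some A"
            using r Inl by (auto simp: ple_u_Inl ple_iff ple_u_Inl_Inr)
          then show ?thesis by blast
        next
          case (Inr a)
          then obtain z where z: "a = x \<oplus> z"
            using le X by (auto simp: ple_u_Inr_Inr ple_iff)
          \<comment> \<open>Here \<open>z\<close> already stands at the right end of
            \<open>\<gamma> c \<oplus> a\<close>, so the comparison with \<open>B\<close> is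
            direct.\<close>
          then have "ple u (Inr (\<gamma> c \<oplus> a)) B" "ple u (Inl c) C" "u (Inr (\<gamma> c \<oplus> a)) (Inl c) = Some A"
            using r Inr by (auto simp: ple_u_Inl ple_u_Inr_Inr ple_iff add_assoc intro: exI[of _ zero])
          then show ?thesis by blast
        qed
      qed
    qed
  qed
qed

end

theorem theorem5p3:
  fixes s :: "'a partial_op" and zero :: 'a and \<gamma> :: "'a \<Rightarrow> 'a"
  assumes "gpea s zero"
    and "total_op s"
    and "unitizing_automorphism s \<gamma>"
  shows "(RDP s \<longleftrightarrow> RDP (unitization s \<gamma>)) \<and>
         (RDP0 s \<longleftrightarrow> RDP0 (unitization s \<gamma>)) \<and>
         (RDP1 s \<longleftrightarrow> RDP1 (unitization s \<gamma>)) \<and>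
         (RDP2 s zero \<longleftrightarrow> RDP2 (unitization s \<gamma>) (Inl zero))"
proof -
  interpret total_gpea_unitization s zero \<gamma>
    using assms
    by (simp add: total_gpea_unitization_def total_gpea_def total_gpea_axioms_def
        total_gpea_unitization_axioms_def)
  show ?thesis
    using RDP_unitization_iff RDP0_unitization_iff RDP1_unitization_iff RDP2_unitization_iff
    by blast
qed

end
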